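(* Let $R$ be a Dedekind ring with quotient field $K$, let $a\in R$ be square-free such that $f(x)=x^n-a$ is irreducible over $R$, and let $\alpha$ be a root of $f(x)$. If every prime ideal of $R$ that contains $n\cdot 1_K$ also contains $a$, then $R[\alpha]$ is integrally closed (in $K(\alpha)$).
   Context: An element $a$ of a Dedekind ring $R$ is square-free if the principal ideal $aR$ is not divisible by the square of any prime ideal of $R$. *)

theory Defs
  imports "HOL-Computational_Algebra.Computational_Algebra"
begin

definition is_ideal :: "'a::comm_ring_1 set \<Rightarrow> bool" where
  "is_ideal I \<longleftrightarrow> 0 \<in> I \<and> (\<forall>x\<in>I. \<forall>y\<in>I. x + y \<in> I) \<and> (\<forall>r x. x \<in> I \<longrightarrow> r * x \<in> I)"

definition prime_ideal :: "'a::comm_ring_1 set \<Rightarrow> bool" where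
  "prime_ideal P \<longleftrightarrow> is_ideal P \<and> P \<noteq> UNIV \<and> (\<forall>x y. x * y \<in> P \<longrightarrow> x \<in> P \<or> y \<in> P)"

definition maximal_ideal :: "'a::comm_ring_1 set \<Rightarrow> bool" where
  "maximal_ideal M \<longleftrightarrow> is_ideal M \<and> M \<noteq> UNIV \<and>
     (\<forall>J. is_ideal J \<and> M \<subseteq> J \<longrightarrow> J = M \<or> J = UNIV)"

definition principal_ideal :: "'a::comm_ring_1 \<Rightarrow> 'a set" where
  "principal_ideal a = {a * r | r. True}"

definition ideals_mult :: "'a::comm_ring_1 set \<Rightarrow> 'a set \<Rightarrow> 'a set" where
  "ideals_mult I J = {(\<Sum>i<(k::nat). x i * y i) | k x y. \<forall>i<k. x i \<in> I \<and> y i \<in> J}"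

definition noetherian_ring :: "'a::comm_ring_1 itself \<Rightarrow> bool" where
  "noetherian_ring _ \<longleftrightarrow> (\<forall>I :: nat \<Rightarrow> 'a set.
      (\<forall>k. is_ideal (I k) \<and> I k \<subseteq> I (Suc k)) \<longrightarrow> (\<exists>N. \<forall>m\<ge>N. I m = I N))"

definition integral_over :: "'b::comm_ring_1 set \<Rightarrow> 'b \<Rightarrow> bool" where
  "integral_over S x \<longleftrightarrow> (\<exists>p :: 'b poly. lead_coeff p = 1 \<and> (\<forall>i. coeff p i \<in> S) \<and> poly p x = 0)"

definition to_fract :: "'a::idom \<Rightarrow> 'a fract" where
  "to_fract x = Fract x 1"

definition integrally_closed_domain :: "'a::idom itself \<Rightarrow> bool" where
  "integrally_closed_domain _ \<longleftrightarrow>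
     (\<forall>x :: 'a fract. integral_over (range to_fract) x \<longrightarrow> x \<in> range to_fract)"

definition dedekind_ring :: "'a::idom itself \<Rightarrow> bool" where
  "dedekind_ring T \<longleftrightarrow> noetherian_ring T \<and> integrally_closed_domain T \<and>
     (\<forall>P :: 'a set. prime_ideal P \<and> P \<noteq> {0} \<longrightarrow> maximal_ideal P)"

definition square_free_elem :: "'a::idom \<Rightarrow> bool" where
  "square_free_elem a \<longleftrightarrow> \<not> (\<exists>P J. prime_ideal P \<and> P \<noteq> {0} \<and> is_ideal J \<and>
      principal_ideal a = ideals_mult (ideals_mult P P) J)"

definition inj_ring_hom :: "('a::comm_ring_1 \<Rightarrow> 'b::comm_ring_1) \<Rightarrow> bool" where
  "inj_ring_hom h \<longleftrightarrow> inj h \<and> h 1 = 1 \<and> (\<forall>x y. h (x + y) = h x + h y) \<and> (\<forall>x y. h (x * y) = h x * h y)"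

definition adjoin :: "('a::comm_ring_1 \<Rightarrow> 'b::field) \<Rightarrow> 'b \<Rightarrow> 'b set" where
  "adjoin h \<alpha> = {poly (map_poly h p) \<alpha> | p. True}"

text \<open>Fraction field of a subring S of a field (= K(alpha) for S = R[alpha]).\<close>
definition frac_field_in :: "'b::field set \<Rightarrow> 'b set" where
  "frac_field_in S = {x / y | x y. x \<in> S \<and> y \<in> S \<and> y \<noteq> 0}"

definition integrally_closed_in :: "'b::field set \<Rightarrow> 'b set \<Rightarrow> bool" where
  "integrally_closed_in S F \<longleftrightarrow> (\<forall>x\<in>F. integral_over S x \<longrightarrow> x \<in> S)"

end

theory Submission
  imports Defs
begin

text \<open>
  Let \<open>S = R[\<alpha>]\<close> and suppose that \<open>\<beta>\<close> in the fraction field is integral over \<open>S\<close> but not in \<open>S\<close>.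
  Replacing \<open>\<beta>\<close> by a multiple \<open>z\<beta>\<close>, the conductor \<open>M = {s \<in> S. s\<beta> \<in> S}\<close> becomes a prime ideal of \<open>S\<close>
  lying over a nonzero prime \<open>P\<close> of \<open>R\<close>. If \<open>M\<close> is generated by one element \<open>t\<close> locally at \<open>M\<close>, then
  \<open>t\<beta> \<in> S\<close> is not in \<open>M\<close>, whereas an integral equation of \<open>\<beta>\<close> puts a power of \<open>t\<beta>\<close> into \<open>tS \<subseteq> M\<close>.

  Such a \<open>t\<close> exists. If \<open>a \<in> P\<close>, then \<open>M\<close> is generated by \<open>P\<close> and \<open>\<alpha>\<close>; square-freeness makes
  \<open>a = \<alpha>\<^sup>n\<close> a uniformizer of \<open>R\<close> at \<open>P\<close>, so \<open>t = \<alpha>\<close> works. If \<open>a \<notin> P\<close>, then \<open>n \<notin> P\<close>, so \<open>x\<^sup>n - a\<close> is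
  separable modulo \<open>P\<close>; \<open>M\<close> is generated by \<open>P\<close> and \<open>g(\<alpha>)\<close> for a simple factor \<open>g\<close> of \<open>x\<^sup>n - a\<close>
  modulo \<open>P\<close>, hence locally by \<open>P\<close> alone, and \<open>t\<close> is a uniformizer of \<open>R\<close> at \<open>P\<close>.
\<close>

section \<open>Ideals\<close>

lemma ideal_zero: "is_ideal I \<Longrightarrow> 0 \<in> I"
  and ideal_add: "is_ideal I \<Longrightarrow> x \<in> I \<Longrightarrow> y \<in> I \<Longrightarrow> x + y \<in> I"
  and ideal_mult_left: "is_ideal I \<Longrightarrow> x \<in> I \<Longrightarrow> r * x \<in> I"
  unfolding is_ideal_def by blast+

lemma ideal_mult_right: "is_ideal I \<Longrightarrow> x \<in> I \<Longrightarrow> x * r \<in> I"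
  by (metis ideal_mult_left mult.commute)

lemma ideal_uminus: "is_ideal I \<Longrightarrow> x \<in> I \<Longrightarrow> - x \<in> I"
  using ideal_mult_left[of I x "- 1"] by simp

lemma ideal_diff: "is_ideal I \<Longrightarrow> x \<in> I \<Longrightarrow> y \<in> I \<Longrightarrow> x - y \<in> I"
  by (metis ideal_add ideal_uminus uminus_add_conv_diff add.commute)

lemma ideal_sum:
  assumes "is_ideal I" "\<And>i. i \<in> A \<Longrightarrow> f i \<in> I"
  shows "sum f A \<in> I"
  using assms(2) by (induction A rule: infinite_finite_induct)
    (auto intro: ideal_zero[OF assms(1)] ideal_add[OF assms(1)])

lemma ideal_eq_UNIV: "is_ideal I \<Longrightarrow> 1 \<in> I \<Longrightarrow> I = UNIV"
  using ideal_mult_left[of I 1] by auto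

lemma prime_ideal_one: "prime_ideal P \<Longrightarrow> 1 \<notin> P"
  using ideal_eq_UNIV unfolding prime_ideal_def by blast

lemma prime_ideal_is_ideal: "prime_ideal P \<Longrightarrow> is_ideal P"
  unfolding prime_ideal_def by blast

lemma prime_ideal_mult: "prime_ideal P \<Longrightarrow> x * y \<in> P \<Longrightarrow> x \<in> P \<or> y \<in> P"
  unfolding prime_ideal_def by blast

lemma prime_ideal_power: "prime_ideal P \<Longrightarrow> x ^ n \<in> P \<Longrightarrow> x \<in> P"
  by (induction n) (auto dest: prime_ideal_one prime_ideal_mult)

text \<open>The ideal \<open>P + yR\<close> is strictly larger than \<open>P\<close>, so it contains
  1.\<close>

lemma maximal_ideal_inverse:
  assumes "maximal_ideal P" "y \<notin> P"
  obtains u where "1 - u * y \<in> P"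
proof -
  have P: "is_ideal P" using assms(1) unfolding maximal_ideal_def by blast
  define J where "J = {p + u * y | p u. p \<in> P}"
  have "is_ideal J"
    unfolding is_ideal_def
  proof (intro conjI ballI allI impI)
    have "0 = 0 + 0 * y" by simp
    then show "0 \<in> J" unfolding J_def using ideal_zero[OF P] by blast
  next
    fix x z assume "x \<in> J" "z \<in> J"
    then obtain p u p' u' where "x = p + u * y" "z = p' + u' * y" "p \<in> P" "p' \<in> P"
      unfolding J_def by blast
    then have "x + z = (p + p') + (u + u') * y" "p + p' \<in> P"
      using ideal_add[OF P] by (auto simp: algebra_simps)
    then show "x + z \<in> J" unfolding J_def by blast
  next
    fix r x assume "x \<in> J"
    then obtain p u where "x = p + u * y" "p \<in> P" unfolding J_def by blast
    then have "r * x = r * p + (r * u) * y" "r * p \<in> P"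
      using ideal_mult_left[OF P] by (auto simp: algebra_simps)
    then show "r * x \<in> J" unfolding J_def by blast
  qed
  moreover have "P \<subseteq> J"
  proof
    fix p assume "p \<in> P"
    moreover have "p = p + 0 * y" by simp
    ultimately show "p \<in> J" unfolding J_def by blast
  qed
  moreover have "J \<noteq> P"
  proof -
    have "y = 0 + 1 * y" by simp
    then have "y \<in> J" unfolding J_def using ideal_zero[OF P] by blast
    then show ?thesis using assms(2) by blast
  qed
  ultimately have "1 \<in> J" using assms(1) unfolding maximal_ideal_def by blast
  then obtain p u where "1 = p + u * y" "p \<in> P" unfolding J_def by blast
  then have "1 - u * y = p" by (simp add: algebra_simps)
  then show thesis using \<open>p \<in> P\<close> that by blast
qed

text \<open>Otherwise every member of \<open>F\<close> lies strictly inside another one, and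
  dependent choice builds an ascending chain that never stabilises.\<close>

lemma noetherian_maximal_member:
  fixes F :: "'a::comm_ring_1 set set"
  assumes "noetherian_ring TYPE('a)" "\<And>I. I \<in> F \<Longrightarrow> is_ideal I" "F \<noteq> {}"
  obtains I where "I \<in> F" "\<And>J. J \<in> F \<Longrightarrow> I \<subseteq> J \<Longrightarrow> J = I"
proof (rule ccontr)
  assume "\<not> thesis"
  then have step: "\<exists>J. J \<in> F \<and> I \<subset> J" if "I \<in> F" for I
    using that \<open>\<And>I. I \<in> F \<Longrightarrow> (\<And>J. J \<in> F \<Longrightarrow> I \<subseteq> J \<Longrightarrow> J = I) \<Longrightarrow> thesis\<close> by blast
  have "\<exists>c. \<forall>k::nat. c k \<in> F \<and> c k \<subset> c (Suc k)"
    by (rule dependent_nat_choice) (use step assms(3) in auto)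
  then obtain c where c: "\<forall>k::nat. c k \<in> F \<and> c k \<subset> c (Suc k)" by blast
  then have "\<forall>k. is_ideal (c k) \<and> c k \<subseteq> c (Suc k)" using assms(2) by blast
  then obtain N where "\<forall>m\<ge>N. c m = c N"
    using assms(1) unfolding noetherian_ring_def by blast
  then have "c (Suc N) = c N" by (metis le_SucI order_refl)
  then show False using c by blast
qed

section \<open>Uniformizers of Dedekind rings\<close>

lemma Fract_power_seq:
  fixes b c :: "'a::idom"
  assumes "c \<noteq> 0" "\<And>k. b * e k = c * e (Suc k)"
  shows "to_fract (e k) = Fract b c ^ k * to_fract (e 0)"
proof (induction k)
  case (Suc k)
  have "to_fract (e (Suc k)) = Fract b c * to_fract (e k)"
    using assms(1) assms(2)[of k] by (simp add: to_fract_def eq_fract mult.commute)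
  then show ?case using Suc by simp
qed simp

lemma to_fract_hom:
  "to_fract (x + y) = to_fract x + to_fract y" "to_fract (x * y) = to_fract x * to_fract y"
  "to_fract (- x) = - to_fract x" "to_fract 0 = 0" "to_fract 1 = 1"
  by (simp_all add: to_fract_def Zero_fract_def One_fract_def)

lemma to_fract_sum: "to_fract (sum f A) = (\<Sum>i\<in>A. to_fract (f i))"
  by (induction A rule: infinite_finite_induct) (auto simp: to_fract_hom)

text \<open>The sequence is \<open>b\<^sup>k e\<^sub>0 / c\<^sup>k\<close>, so the ascending chain condition applied to the ideals
  generated by its initial segments makes \<open>b / c\<close> integral.\<close>

lemma noetherian_integrally_closed_dvd:
  fixes b c :: "'a::idom"
  assumes noeth: "noetherian_ring TYPE('a)" and ic: "integrally_closed_domain TYPE('a)"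
    and "c \<noteq> 0" "e 0 \<noteq> 0" and e: "\<And>k. b * e k = c * e (Suc k)"
  shows "c dvd b"
proof -
  define I where "I k = {\<Sum>i\<le>k. r i * e i | r. True}" for k :: nat
  have ideal: "is_ideal (I k)" for k
    unfolding is_ideal_def
  proof (intro conjI ballI allI impI)
    have "0 = (\<Sum>i\<le>k. 0 * e i)" by simp
    then show "0 \<in> I k" unfolding I_def by (intro CollectI exI[of _ "\<lambda>_. 0"]) simp
  next
    fix x y assume "x \<in> I k" "y \<in> I k"
    then obtain r s where "x = (\<Sum>i\<le>k. r i * e i)" "y = (\<Sum>i\<le>k. s i * e i)"
      unfolding I_def by blast
    then have "x + y = (\<Sum>i\<le>k. (r i + s i) * e i)"
      by (simp add: sum.distrib algebra_simps)
    then show "x + y \<in> I k" unfolding I_def by (intro CollectI exI[of _ "\<lambda>i. r i + s i"]) simp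
  next
    fix t x assume "x \<in> I k"
    then obtain r where "x = (\<Sum>i\<le>k. r i * e i)" unfolding I_def by blast
    then have "t * x = (\<Sum>i\<le>k. (t * r i) * e i)"
      by (simp add: sum_distrib_left mult.assoc)
    then show "t * x \<in> I k" unfolding I_def by (intro CollectI exI[of _ "\<lambda>i. t * r i"]) simp
  qed
  have "I k \<subseteq> I (Suc k)" for k
  proof
    fix x assume "x \<in> I k"
    then obtain r where r: "x = (\<Sum>i\<le>k. r i * e i)" unfolding I_def by blast
    have "(\<Sum>i\<le>k. (if i \<le> k then r i else 0) * e i) = x"
      unfolding r by (rule sum.cong) auto
    then have "x = (\<Sum>i\<le>Suc k. (if i \<le> k then r i else 0) * e i)" by simp
    then show "x \<in> I (Suc k)" unfolding I_def
      by (intro CollectI exI[of _ "\<lambda>i. if i \<le> k then r i else 0"]) simp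
  qed
  then obtain N where N: "I (Suc N) = I N"
    using noeth ideal unfolding noetherian_ring_def by (metis le_SucI order_refl)
  have "e (Suc N) = (\<Sum>i\<le>Suc N. (if i = Suc N then 1 else 0) * e i)"
    by simp
  then have "e (Suc N) \<in> I (Suc N)" unfolding I_def
    by (intro CollectI exI[of _ "\<lambda>i. if i = Suc N then 1 else 0"]) simp
  then have "e (Suc N) \<in> I N" by (simp only: N)
  then obtain r where r: "e (Suc N) = (\<Sum>i\<le>N. r i * e i)" unfolding I_def by blast
  define x where "x = Fract b c"
  define E where "E = to_fract (e 0)"
  have pow: "to_fract (e k) = x ^ k * E" for k
    unfolding x_def E_def using assms(3) e by (rule Fract_power_seq)
  have "x ^ Suc N * E = (\<Sum>i\<le>N. to_fract (r i) * x ^ i) * E"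
    using arg_cong[OF r, of to_fract]
    by (simp only: to_fract_sum to_fract_hom pow sum_distrib_right mult.assoc)
  moreover have "E \<noteq> 0"
    using assms(4) by (simp add: E_def to_fract_def Zero_fract_def eq_fract)
  ultimately have rel: "x ^ Suc N = (\<Sum>i\<le>N. to_fract (r i) * x ^ i)"
    by simp
  \<comment> \<open>Cancelling the nonzero factor \<open>E\<close> has turned membership of
    \<open>e (Suc N)\<close> in \<open>I N\<close> into a monic equation of degree
    \<open>Suc N\<close> for \<open>b / c\<close>; \<open>p\<close> is its polynomial.\<close>
  define p where "p = monom 1 (Suc N) - (\<Sum>i\<le>N. monom (to_fract (r i)) i)"
  have coeff_p: "coeff p i = (if i = Suc N then 1 else if i \<le> N then - to_fract (r i) else 0)" for i
    by (auto simp: p_def coeff_sum)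
  have "degree p = Suc N"
    by (rule antisym, rule degree_le) (auto simp: coeff_p intro: le_degree)
  then have "lead_coeff p = 1" by (simp add: coeff_p)
  moreover have "\<forall>i. coeff p i \<in> range to_fract"
    by (auto simp: coeff_p simp flip: to_fract_hom)
  moreover have "poly p x = 0"
    using rel by (simp add: p_def poly_sum poly_monom)
  ultimately have "integral_over (range to_fract) x"
    unfolding integral_over_def by blast
  then obtain y where "x = to_fract y"
    using ic unfolding integrally_closed_domain_def by blast
  then have "b = y * c" using assms(3) by (simp add: x_def to_fract_def eq_fract)
  then show ?thesis by simp
qed

text \<open>In other words, \<open>P\<close> is an associated prime of \<open>R / cR\<close>.\<close>

lemma dedekind_prime_colon:
  fixes P :: "'a::idom set"
  assumes ded: "dedekind_ring TYPE('a)" and P: "prime_ideal P" and "c \<in> P" "c \<noteq> 0"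
  obtains b where "P = {y. c dvd y * b}"
proof -
  have PI: "is_ideal P" using P by (rule prime_ideal_is_ideal)
  \<comment> \<open>\<open>col x\<close> is the annihilator of the class of \<open>x\<close> in
    \<open>R / cR\<close>. One that is maximal among those contained in \<open>P\<close> turns out
    to be prime.\<close>
  define col where "col x = {y. c dvd y * x}" for x
  have colI: "is_ideal (col x)" for x
    by (auto simp: is_ideal_def col_def distrib_right mult.assoc)
  have "col 1 \<subseteq> P"
    using ideal_mult_right[OF PI \<open>c \<in> P\<close>] by (auto simp: col_def dvd_def)
  then have "{col x | x. col x \<subseteq> P} \<noteq> {}" by blast
  moreover have "noetherian_ring TYPE('a)" using ded unfolding dedekind_ring_def by blast
  ultimately obtain I where I: "I \<in> {col x | x. col x \<subseteq> P}"
    "\<And>J. J \<in> {col x | x. col x \<subseteq> P} \<Longrightarrow> I \<subseteq> J \<Longrightarrow> J = I"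
    using colI by (elim noetherian_maximal_member[rotated 2]) auto
  from I(1) obtain x where x: "I = col x" and sub: "col x \<subseteq> P" by blast
  have mx: "col z = col x" if "col z \<subseteq> P" "col x \<subseteq> col z" for z
    using I(2)[of "col z"] that unfolding x by blast
  have mono: "col x \<subseteq> col (x * w)" for w
    by (auto simp: col_def simp flip: mult.assoc)
  have "prime_ideal (col x)"
    unfolding prime_ideal_def
  proof (intro conjI allI impI)
    show "is_ideal (col x)" by (rule colI)
    show "col x \<noteq> UNIV" using sub prime_ideal_one[OF P] by blast
    fix u v assume uv: "u * v \<in> col x"
    show "u \<in> col x \<or> v \<in> col x"
    proof (cases "col (x * v) \<subseteq> P")
      case True
      then have "col (x * v) = col x" using mx mono by blast
      moreover have "u \<in> col (x * v)" using uv by (simp add: col_def mult.commute mult.left_commute)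
      ultimately show ?thesis by blast
    next
      case False
      then obtain w where w: "w \<notin> P" "w \<in> col (x * v)" by blast
      \<comment> \<open>Since \<open>w\<close> is outside the prime \<open>P\<close>, passing from
        \<open>x\<close> to \<open>x * w\<close> keeps the annihilator inside \<open>P\<close>, so
        maximality applies to \<open>x * w\<close> in place of \<open>x * v\<close>.\<close>
      have "col (x * w) \<subseteq> P"
      proof
        fix z assume "z \<in> col (x * w)"
        then have "z * w \<in> col x" by (simp add: col_def mult.commute mult.left_commute)
        then show "z \<in> P" using sub w(1) prime_ideal_mult[OF P] by blast
      qed
      then have "col (x * w) = col x" using mx mono by blast
      moreover have "v \<in> col (x * w)" using w(2) by (simp add: col_def mult.commute mult.left_commute)
      ultimately show ?thesis by blast
    qed
  qed
  \<comment> \<open>The element \<open>c\<close> makes this prime nonzero, hence maximal, which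
    turns its inclusion in \<open>P\<close> into an equality.\<close>
  moreover have "c \<in> col x" by (simp add: col_def)
  ultimately have "maximal_ideal (col x)"
    using ded \<open>c \<noteq> 0\<close> unfolding dedekind_ring_def by blast
  then have "P = col x" using sub PI P unfolding maximal_ideal_def prime_ideal_def by blast
  then show thesis using that unfolding col_def by blast
qed

text \<open>In terms of fractional ideals: \<open>b / c\<close> lies in the inverse of \<open>P\<close>, and \<open>1 = (b / c) p + q\<close>
  exhibits \<open>P\<close> as invertible.\<close>

lemma dedekind_prime_invertible:
  fixes P :: "'a::idom set"
  assumes ded: "dedekind_ring TYPE('a)" and P: "prime_ideal P" and "P \<noteq> {0}"
  obtains c p q b where "c \<noteq> 0" "p \<in> P" "q \<in> P" "\<forall>x\<in>P. c dvd b * x" "b * p = c * (1 - q)"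
proof -
  have PI: "is_ideal P" using P by (rule prime_ideal_is_ideal)
  have mxP: "maximal_ideal P" using ded P assms(3) unfolding dedekind_ring_def by blast
  obtain c where c: "c \<in> P" "c \<noteq> 0" using ideal_zero[OF PI] assms(3) by blast
  obtain b where b: "P = {y. c dvd y * b}" using dedekind_prime_colon[OF ded P c] by blast
  have nb: "\<not> c dvd b" using b prime_ideal_one[OF P] by auto
  have dvd: "c dvd b * x" if "x \<in> P" for x using that b by (simp add: mult.commute)
  \<comment> \<open>Otherwise multiplication by \<open>b / c\<close> maps \<open>P\<close> into
    itself; iterating it from \<open>c\<close> gives a sequence that forces
    \<open>c dvd b\<close>.\<close>
  have "\<exists>x\<in>P. \<exists>y. b * x = c * y \<and> y \<notin> P"
  proof (rule ccontr)
    assume "\<not> ?thesis"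
    then have "\<exists>y. y \<in> P \<and> b * x = c * y" if "x \<in> P" for x
      using dvd[OF that] that unfolding dvd_def by blast
    then obtain \<phi> where \<phi>: "\<And>x. x \<in> P \<Longrightarrow> \<phi> x \<in> P \<and> b * x = c * \<phi> x" by metis
    define e where "e k = (\<phi> ^^ k) c" for k
    have eP: "e k \<in> P" for k by (induction k) (auto simp: e_def c(1) \<phi>)
    have "b * e k = c * e (Suc k)" for k using \<phi>[OF eP[of k]] by (simp add: e_def)
    moreover have "e 0 \<noteq> 0" using c(2) by (simp add: e_def)
    ultimately have "c dvd b"
      using noetherian_integrally_closed_dvd[of c e b] ded c(2) unfolding dedekind_ring_def by blast
    then show False using nb by blast
  qed
  then obtain x y where xy: "x \<in> P" "b * x = c * y" "y \<notin> P" by blast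
  obtain u where u: "1 - u * y \<in> P" using maximal_ideal_inverse[OF mxP xy(3)] by blast
  \<comment> \<open>The witnesses are \<open>p = u * x\<close> and \<open>q = 1 - u * y\<close>,
    where \<open>u\<close> inverts \<open>y\<close> modulo \<open>P\<close>.\<close>
  have "b * (u * x) = u * (b * x)" by (simp add: mult.left_commute)
  also have "\<dots> = c * (1 - (1 - u * y))" by (simp add: xy(2) mult.left_commute)
  finally show thesis
    using that[OF c(2) ideal_mult_left[OF PI xy(1)] u] dvd by blast
qed

lemma dvd_of_mult_eq: "c \<noteq> 0 \<Longrightarrow> c * u = c * (a * v) \<Longrightarrow> a dvd u" for a c u v :: "'a::idom"
  by (metis dvd_triv_left mult_left_cancel)

text \<open>Invertibility supplies \<open>\<pi> = p\<close> and \<open>s = 1 - q\<close>: as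
  \<open>s = (b / c) p\<close>, the product \<open>s x\<close> is \<open>p\<close> times the ring
  element \<open>(b / c) x\<close>. After localising at \<open>P\<close> the factor \<open>s\<close>
  is a unit, so \<open>\<pi>\<close> generates \<open>P\<close> there.\<close>

lemma dedekind_uniformizer:
  fixes P :: "'a::idom set"
  assumes ded: "dedekind_ring TYPE('a)" and P: "prime_ideal P" and "P \<noteq> {0}"
  obtains \<pi> s where "\<pi> \<in> P" "\<pi> \<noteq> 0" "s \<notin> P" "\<And>x. x \<in> P \<Longrightarrow> \<pi> dvd s * x"
proof -
  have PI: "is_ideal P" using P by (rule prime_ideal_is_ideal)
  obtain c p q b where h: "c \<noteq> 0" "p \<in> P" "q \<in> P" "\<forall>x\<in>P. c dvd b * x"
    "b * p = c * (1 - q)" using dedekind_prime_invertible[OF assms] by blast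
  have s: "1 - q \<notin> P" using ideal_add[OF PI _ h(3), of "1 - q"] prime_ideal_one[OF P] by auto
  then have "p \<noteq> 0" using h(1,5) ideal_zero[OF PI] by auto
  moreover have "p dvd (1 - q) * x" if x: "x \<in> P" for x
  proof -
    obtain r where r: "b * x = c * r" using bspec[OF h(4) x] by blast
    have "c * ((1 - q) * x) = p * (b * x)"
      using h(5) by algebra
    also have "\<dots> = c * (p * r)" by (simp add: r mult.left_commute)
    finally show ?thesis by (rule dvd_of_mult_eq[OF h(1)])
  qed
  ultimately show thesis using that h(2) s by blast
qed

section \<open>Products of ideals and square-free elements\<close>

lemma ideals_mult_I: "x \<in> I \<Longrightarrow> y \<in> J \<Longrightarrow> x * y \<in> ideals_mult I J"
  unfolding ideals_mult_def
  by (intro CollectI exI[of _ "Suc 0"] exI[of _ "\<lambda>_. x"] exI[of _ "\<lambda>_. y"]) simp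

lemma ideals_mult_subset:
  assumes "is_ideal K" "\<And>x y. x \<in> I \<Longrightarrow> y \<in> J \<Longrightarrow> x * y \<in> K"
  shows "ideals_mult I J \<subseteq> K"
  unfolding ideals_mult_def using assms by (auto intro!: ideal_sum)

lemma ideals_mult_add:
  assumes "u \<in> ideals_mult I J" "v \<in> ideals_mult I J"
  shows "u + v \<in> ideals_mult I J"
proof -
  obtain k x y where u: "u = (\<Sum>i<(k::nat). x i * y i)" "\<forall>i<k. x i \<in> I \<and> y i \<in> J"
    using assms(1) unfolding ideals_mult_def by blast
  obtain l x' y' where v: "v = (\<Sum>i<(l::nat). x' i * y' i)" "\<forall>i<l. x' i \<in> I \<and> y' i \<in> J"
    using assms(2) unfolding ideals_mult_def by blast
  \<comment> \<open>The two families are concatenated, the second one shifted by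
    \<open>k\<close>.\<close>
  define X where "X i = (if i < k then x i else x' (i - k))" for i
  define Y where "Y i = (if i < k then y i else y' (i - k))" for i
  have "(\<Sum>i<k + l. X i * Y i) = (\<Sum>i<k. X i * Y i) + (\<Sum>i<l. X (k + i) * Y (k + i))"
    by (induction l) (auto simp: add.assoc)
  then have "u + v = (\<Sum>i<k + l. X i * Y i)"
    by (simp add: u v X_def Y_def)
  moreover have "\<forall>i<k + l. X i \<in> I \<and> Y i \<in> J"
    using u v by (auto simp: X_def Y_def)
  ultimately show ?thesis unfolding ideals_mult_def by blast
qed

text \<open>This is the colon ideal \<open>(aR : A)\<close>; it supplies the cofactor of the square
  of \<open>P\<close> in the square-free argument.\<close>

lemma is_ideal_colon:
  fixes a :: "'a::comm_ring_1"
  shows "is_ideal {z. \<forall>x\<in>A. a dvd x * z}"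
  by (auto simp: is_ideal_def distrib_left mult.left_commute)

lemma is_ideal_principal: "is_ideal (principal_ideal a)"
proof -
  have "principal_ideal a = {z. \<forall>x\<in>{1}. a dvd x * z}"
    by (auto simp: principal_ideal_def dvd_def)
  then show ?thesis using is_ideal_colon by metis
qed

text \<open>The required \<open>s\<close> is \<open>r = (b / c) a\<close>. If it were in
  \<open>P\<close>, then \<open>(b / c)^2 a\<close> would also be in \<open>R\<close>, and the
  square of \<open>P\<close> would divide \<open>aR\<close> with cofactor
  \<open>(aR : P^2)\<close>.\<close>

lemma square_free_uniformizer:
  fixes P :: "'a::idom set"
  assumes ded: "dedekind_ring TYPE('a)" and P: "prime_ideal P" "P \<noteq> {0}"
    and sqf: "square_free_elem a" and a: "a \<in> P"
  obtains s where "s \<notin> P" "\<And>x. x \<in> P \<Longrightarrow> a dvd s * x"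
proof -
  have PI: "is_ideal P" using P by (blast intro: prime_ideal_is_ideal)
  obtain c p q b where h: "c \<noteq> 0" "p \<in> P" "q \<in> P" "\<forall>x\<in>P. c dvd b * x"
    "b * p = c * (1 - q)" using dedekind_prime_invertible[OF ded P] by blast
  obtain r where r: "b * a = c * r" using bspec[OF h(4) a] by blast
  have "r \<notin> P"
  proof
    assume "r \<in> P"
    then obtain r' where r': "b * r = c * r'" using h(4) by blast
    define J where "J = {z. \<forall>x\<in>{x * y | x y. x \<in> P \<and> y \<in> P}. a dvd x * z}"
    have JI: "is_ideal J" unfolding J_def by (rule is_ideal_colon)
    have J: "z \<in> J \<longleftrightarrow> (\<forall>x\<in>P. \<forall>y\<in>P. a dvd x * y * z)" for z unfolding J_def by blast
    have aJ: "a \<in> J" unfolding J by simp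
    have rJ: "r \<in> J" unfolding J
    proof (intro ballI)
      fix x y assume "x \<in> P" "y \<in> P"
      then obtain x' where "b * x = c * x'" using h(4) by blast
      then have "c * (x * y * r) = c * (a * (x' * y))" using r by algebra
      then show "a dvd x * y * r" by (rule dvd_of_mult_eq[OF h(1)])
    qed
    have r'J: "r' \<in> J" unfolding J
    proof (intro ballI)
      fix x y assume "x \<in> P" "y \<in> P"
      then obtain x' y' where "b * x = c * x'" "b * y = c * y'" using h(4) by blast
      then have "c * c * (x * y * r') = c * c * (a * (x' * y'))" using r r' by algebra
      moreover have "c * c \<noteq> 0" using h(1) by simp
      ultimately show "a dvd x * y * r'" using dvd_of_mult_eq by blast
    qed
    \<comment> \<open>This expands \<open>a = a ((b / c) p + q)^2\<close>, whose bracket equals 1,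
      with denominators cleared; each summand then lies in \<open>P^2 J\<close>.\<close>
    have "c * c * a = c * c * (p * p * r' + p * q * (r + r) + q * q * a)"
      using h(5) r r' by algebra
    moreover have "c * c \<noteq> 0" using h(1) by simp
    ultimately have aeq: "a = p * p * r' + p * q * (r + r) + q * q * a"
      using mult_left_cancel by blast
    have "u * z \<in> principal_ideal a" if u: "u \<in> ideals_mult P P" and z: "z \<in> J" for u z
    proof -
      have "is_ideal {u. \<forall>x\<in>{z}. a dvd x * u}" by (rule is_ideal_colon)
      then have "ideals_mult P P \<subseteq> {u. \<forall>x\<in>{z}. a dvd x * u}"
        by (rule ideals_mult_subset) (use z J in \<open>auto simp: mult.commute\<close>)
      then have "a dvd u * z" using u by (auto simp: mult.commute)
      then show ?thesis by (auto simp: principal_ideal_def dvd_def)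
    qed
    then have "ideals_mult (ideals_mult P P) J \<subseteq> principal_ideal a"
      by (rule ideals_mult_subset[OF is_ideal_principal])
    moreover have "principal_ideal a \<subseteq> ideals_mult (ideals_mult P P) J"
    proof
      fix x assume "x \<in> principal_ideal a"
      then obtain t where "x = a * t" by (auto simp: principal_ideal_def)
      then have "x = p * p * (r' * t) + p * q * ((r + r) * t) + q * q * (a * t)"
        using aeq by algebra
      moreover have "p * p * (r' * t) + p * q * ((r + r) * t) + q * q * (a * t)
          \<in> ideals_mult (ideals_mult P P) J"
        by (intro ideals_mult_add ideals_mult_I h(2,3) ideal_mult_right[OF JI] ideal_add[OF JI] aJ rJ r'J)
      ultimately show "x \<in> ideals_mult (ideals_mult P P) J" by (simp only:)
    qed
    ultimately have "principal_ideal a = ideals_mult (ideals_mult P P) J" by blast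
    then show False using sqf P JI unfolding square_free_elem_def by blast
  qed
  moreover have "a dvd r * x" if x: "x \<in> P" for x
  proof -
    obtain y where "b * x = c * y" using bspec[OF h(4) x] by blast
    then have "c * (r * x) = c * (a * y)" using r by algebra
    then show ?thesis by (rule dvd_of_mult_eq[OF h(1)])
  qed
  ultimately show thesis using that by blast
qed

section \<open>Ideals of polynomial rings\<close>

lemma monom_mem_ideal:
  assumes "is_ideal J" "[:c:] \<in> J"
  shows "monom c d \<in> J"
proof -
  have "monom c d = monom 1 d * [:c:]" by (simp add: smult_monom)
  then show ?thesis using ideal_mult_left[OF assms] by metis
qed

lemma poly_mem_ideal_of_coeffs:
  assumes J: "is_ideal J" and "\<And>i. [:coeff r i:] \<in> J"
  shows "r \<in> J"
proof -
  have "(\<Sum>i\<le>degree r. monom (coeff r i) i) \<in> J"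
    using assms by (intro ideal_sum monom_mem_ideal)
  then show ?thesis by (simp add: poly_as_sum_of_monoms)
qed

text \<open>A top coefficient outside the contraction of \<open>J\<close> is invertible modulo it,
  which would yield a monic member of \<open>J\<close> of degree below \<open>d\<close>. Stripping
  the top term and inducting on the bound \<open>k\<close> reaches the other coefficients.\<close>

lemma min_monic_coeffs:
  fixes J :: "'a::comm_ring_1 poly set"
  assumes J: "is_ideal J" and mx: "maximal_ideal {c. [:c:] \<in> J}"
    and min: "\<And>g'. g' \<in> J \<Longrightarrow> lead_coeff g' = 1 \<Longrightarrow> d \<le> degree g'"
    and "r \<in> J" "k \<le> d" "\<And>i. k \<le> i \<Longrightarrow> coeff r i = 0"
  shows "[:coeff r i:] \<in> J"
  using assms(4-6)
proof (induction k arbitrary: r i)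
  case 0
  then show ?case using ideal_zero[OF J] by simp
next
  case (Suc k)
  define c where "c = coeff r k"
  have c: "[:c:] \<in> J"
  proof (rule ccontr)
    assume "[:c:] \<notin> J"
    then obtain u where u: "[:1 - u * c:] \<in> J" using maximal_ideal_inverse[OF mx, of c] by blast
    \<comment> \<open>The coefficient at \<open>k\<close> becomes \<open>u * c\<close>, and the
      added monomial, itself in \<open>J\<close>, corrects it to 1.\<close>
    define r' where "r' = [:u:] * r + monom (1 - u * c) k"
    have "r' \<in> J" unfolding r'_def
      by (intro ideal_add[OF J] ideal_mult_left[OF J] Suc.prems(1) monom_mem_ideal[OF J] u)
    moreover have 1: "coeff r' k = 1" by (simp add: r'_def c_def)
    moreover have "degree r' \<le> k"
      by (rule degree_le) (auto simp: r'_def Suc.prems(3))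
    moreover have "k \<le> degree r'" using 1 by (intro le_degree) simp
    ultimately have "d \<le> k" using min[of r'] by simp
    then show False using Suc.prems(2) by simp
  qed
  have "[:coeff (r - monom c k) i:] \<in> J"
  proof (rule Suc.IH)
    show "r - monom c k \<in> J"
      by (intro ideal_diff[OF J] Suc.prems(1) monom_mem_ideal[OF J] c)
    show "k \<le> d" using Suc.prems(2) by simp
    show "coeff (r - monom c k) j = 0" if "k \<le> j" for j
      using that Suc.prems(3)[of j] by (cases "j = k") (auto simp: c_def)
  qed
  then show ?case using c by (cases "i = k") (auto simp: c_def)
qed

text \<open>Pseudo-division by a monic \<open>g\<close> needs no scaling, and the remainder has
  degree below the minimum. Hence \<open>J\<close> is generated by \<open>g\<close> and its
  constants.\<close>

lemma min_monic_division:
  fixes J :: "'a::idom poly set"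
  assumes J: "is_ideal J" and mx: "maximal_ideal {c. [:c:] \<in> J}"
    and g: "g \<in> J" "lead_coeff g = 1"
    and min: "\<And>g'. g' \<in> J \<Longrightarrow> lead_coeff g' = 1 \<Longrightarrow> degree g \<le> degree g'"
    and p: "p \<in> J"
  obtains q r where "p = g * q + r" "\<And>i. [:coeff r i:] \<in> J"
proof -
  obtain q r where qr: "pseudo_divmod p g = (q, r)" by fastforce
  have "g \<noteq> 0" using g(2) by auto
  from pseudo_divmod[OF this qr] have eq: "p = g * q + r" and deg: "r = 0 \<or> degree r < degree g"
    using g(2) by auto
  have "r = p - g * q" using eq by simp
  then have "r \<in> J" using ideal_diff[OF J p ideal_mult_right[OF J g(1)]] by simp
  moreover have "coeff r i = 0" if "degree g \<le> i" for i
    using deg that by (auto intro: coeff_eq_0)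
  ultimately have "[:coeff r i:] \<in> J" for i
    using min_monic_coeffs[OF J mx min, of r "degree g"] by blast
  then show thesis using that eq by blast
qed

section \<open>Evaluation at the root and conductors\<close>

locale adjunction =
  fixes h :: "'a::idom \<Rightarrow> 'b::field" and \<alpha> :: 'b
  assumes hom: "inj_ring_hom h"
begin

definition ev :: "'a poly \<Rightarrow> 'b" where
  "ev p = poly (map_poly h p) \<alpha>"

lemma adjoin_eq: "adjoin h \<alpha> = range ev"
  by (auto simp: adjoin_def ev_def)

lemma h_hom: "h (x + y) = h x + h y" "h (x * y) = h x * h y" "h 1 = 1"
  using hom by (auto simp: inj_ring_hom_def)

lemma h_zero: "h 0 = 0"
  by (metis h_hom(1) add.right_neutral add_cancel_right_right)

lemma h_eq_zero: "h x = 0 \<longleftrightarrow> x = 0"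
  using hom h_zero by (metis inj_ring_hom_def injD)

lemma ev_pCons: "ev (pCons c p) = h c + \<alpha> * ev p"
  by (simp add: ev_def map_poly_pCons h_zero)

lemma ev_zero: "ev 0 = 0"
  by (simp add: ev_def)

lemma ev_const: "ev [:c:] = h c"
  by (simp add: ev_pCons ev_zero)

lemma ev_one: "ev 1 = 1"
  using ev_const[of 1] by (simp add: h_hom flip: one_pCons)

lemma ev_add: "ev (p + q) = ev p + ev q"
  by (induction p q rule: poly_induct2) (auto simp: ev_pCons ev_zero h_hom algebra_simps)

lemma ev_smult: "ev (smult c p) = h c * ev p"
  by (induction p) (auto simp: ev_pCons ev_zero h_hom algebra_simps)

lemma ev_mult: "ev (p * q) = ev p * ev q"
  by (induction p) (auto simp: ev_pCons ev_zero ev_add ev_smult h_zero algebra_simps)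

lemma ev_uminus: "ev (- p) = - ev p"
  using ev_add[of p "- p"] by (simp add: ev_zero add_eq_0_iff)

lemma ev_diff: "ev (p - q) = ev p - ev q"
  using ev_add[of p "- q"] by (simp add: ev_uminus)

lemma ev_power: "ev (p ^ k) = ev p ^ k"
  by (induction k) (auto simp: ev_one ev_mult)

lemma ev_sum: "ev (sum f A) = (\<Sum>i\<in>A. ev (f i))"
  by (induction A rule: infinite_finite_induct) (auto simp: ev_zero ev_add)

text \<open>The conductor ideal of \<open>R[\<alpha>]\<close> is encoded by its preimage in
  \<open>R[X]\<close>, which contains the kernel of \<open>ev\<close>, so that the notions for
  ideals of a whole type apply.\<close>

definition conductor :: "'b \<Rightarrow> 'a poly set" where
  "conductor \<beta> = {p. ev p * \<beta> \<in> range ev}"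

lemma is_ideal_conductor: "is_ideal (conductor \<beta>)"
  unfolding is_ideal_def conductor_def
proof (intro conjI ballI allI impI; clarsimp)
  show "ev 0 * \<beta> \<in> range ev" using ev_zero by (metis mult_zero_left rangeI)
next
  fix x y p q assume "ev x * \<beta> = ev p" "ev y * \<beta> = ev q"
  then have "ev (x + y) * \<beta> = ev (p + q)" by (simp add: ev_add distrib_right)
  then show "ev (x + y) * \<beta> \<in> range ev" by simp
next
  fix r x p assume "ev x * \<beta> = ev p"
  then have "ev (r * x) * \<beta> = ev (r * p)" by (simp add: ev_mult mult.assoc)
  then show "ev (r * x) * \<beta> \<in> range ev" by simp
qed

lemma conductor_cong: "ev p = ev q \<Longrightarrow> p \<in> conductor \<beta> \<longleftrightarrow> q \<in> conductor \<beta>"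
  by (simp add: conductor_def)

lemma conductor_mult: "p \<in> conductor (ev q * \<beta>) \<longleftrightarrow> p * q \<in> conductor \<beta>"
  by (simp add: conductor_def ev_mult mult.assoc)

lemma conductor_mono: "conductor \<beta> \<subseteq> conductor (ev q * \<beta>)"
  using ideal_mult_right[OF is_ideal_conductor] by (auto simp: conductor_mult)

lemma one_mem_conductor: "1 \<in> conductor \<beta> \<longleftrightarrow> \<beta> \<in> range ev"
  by (simp add: conductor_def ev_one)

lemma mem_conductor_iff: "p \<in> conductor \<beta> \<longleftrightarrow> ev p * \<beta> \<in> range ev"
  by (simp add: conductor_def)

lemma mem_conductor_of_root: "ev p = 0 \<Longrightarrow> p \<in> conductor \<beta>"
  by (metis ev_zero mem_conductor_iff mult_zero_left rangeI)

text \<open>Take \<open>u\<close> of least degree whose value is a nonzero multiple of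
  \<open>ev y\<close>, and \<open>m\<close> nonzero of least degree vanishing at \<alpha>.
  Pseudo-division of \<open>u\<close> by \<open>m\<close>, then of \<open>m\<close> by
  \<open>u\<close>, contradicts minimality unless \<open>u\<close> is constant. Thus denominators
  can be chosen in \<open>R\<close>.\<close>

lemma nonzero_constant_multiple:
  assumes f: "f \<noteq> 0" "ev f = 0" and y: "ev y \<noteq> 0"
  obtains r w where "r \<noteq> 0" "h r = ev (y * w)"
proof -
  define A where "A u \<longleftrightarrow> ev u \<noteq> 0 \<and> (\<exists>w. ev u = ev (y * w))" for u
  define B where "B m \<longleftrightarrow> m \<noteq> 0 \<and> ev m = 0" for m
  have "A y" unfolding A_def using y by (metis mult.right_neutral)
  then obtain u where u: "A u" and umin: "\<And>v. A v \<Longrightarrow> degree u \<le> degree v"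
    using ex_has_least_nat[of A y degree] by blast
  have "B f" using f by (simp add: B_def)
  then obtain m where m: "B m" and mmin: "\<And>v. B v \<Longrightarrow> degree m \<le> degree v"
    using ex_has_least_nat[of B f degree] by blast
  obtain w where w: "ev u = ev (y * w)" using u unfolding A_def by blast
  have u0: "u \<noteq> 0" using u by (auto simp: A_def ev_zero)
  have m0: "m \<noteq> 0" using m by (simp add: B_def)
  have um: "degree u < degree m"
  proof (rule ccontr)
    assume less: "\<not> degree u < degree m"
    obtain q r where qr: "pseudo_divmod u m = (q, r)" by fastforce
    define c where "c = lead_coeff m ^ (Suc (degree u) - degree m)"
    have eq: "smult c u = m * q + r" and deg: "r = 0 \<or> degree r < degree m"
      using pseudo_divmod[OF m0 qr] by (auto simp: c_def)
    have "c \<noteq> 0" using m0 by (simp add: c_def)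
    have evr: "ev r = h c * ev u"
      using arg_cong[OF eq, of ev] m by (simp add: ev_smult ev_add ev_mult B_def)
    then have "ev r \<noteq> 0" using u \<open>c \<noteq> 0\<close> by (simp add: A_def h_eq_zero)
    moreover have "ev r = ev (y * (smult c w))" using evr w by (simp add: ev_mult ev_smult)
    ultimately have "A r" unfolding A_def by blast
    moreover have "r \<noteq> 0" using \<open>ev r \<noteq> 0\<close> by (auto simp: ev_zero)
    ultimately show False using umin[of r] deg less by simp
  qed
  have "degree u = 0"
  proof (rule ccontr)
    assume pos: "degree u \<noteq> 0"
    obtain q r where qr: "pseudo_divmod m u = (q, r)" by fastforce
    define c where "c = lead_coeff u ^ (Suc (degree m) - degree u)"
    have eq: "smult c m = u * q + r" and deg: "r = 0 \<or> degree r < degree u"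
      using pseudo_divmod[OF u0 qr] by (auto simp: c_def)
    have "c \<noteq> 0" using u0 by (simp add: c_def)
    have evr: "ev r = - (ev u * ev q)"
      using arg_cong[OF eq, of ev] m
      by (simp add: ev_smult ev_add ev_mult B_def add_eq_0_iff2 minus_equation_iff)
    have dr: "degree r < degree u" using deg pos by auto
    have dm: "degree (u * q + r) = degree m" using eq \<open>c \<noteq> 0\<close> by (metis degree_smult_eq)
    have q0: "q \<noteq> 0" using dm dr um by auto
    then have "degree (u * q) = degree u + degree q" using u0 by (simp add: degree_mult_eq)
    \<comment> \<open>A nonzero quotient of degree below that of \<open>m\<close> cannot vanish at
      \<alpha>, so the remainder has a nonzero value and competes with \<open>u\<close>.\<close>
    then have "degree q < degree m"
      using dm dr pos by (simp add: degree_add_eq_left)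
    then have "ev q \<noteq> 0" using mmin[of q] q0 by (auto simp: B_def)
    then have "ev r \<noteq> 0" using evr u by (simp add: A_def)
    moreover have "ev r = ev (y * (- (w * q)))" using evr w by (simp add: ev_mult ev_uminus)
    ultimately have "A r" unfolding A_def by blast
    then show False using umin[of r] dr by simp
  qed
  then obtain r where "u = [:r:]" by (rule degree_eq_zeroE)
  then have "r \<noteq> 0" "h r = ev (y * w)" using u0 w by (auto simp: ev_const)
  then show thesis using that by blast
qed

text \<open>Among the multiples \<open>ev z * \<beta>\<close> outside the ring, first make the contraction of the
  conductor to the base ring maximal, then make the degree of a monic member of the conductor
  minimal; both steps force primality.\<close>

lemma prime_conductor:
  assumes ded: "dedekind_ring TYPE('a)"
    and f: "lead_coeff f = 1" "ev f = 0"
    and \<beta>: "\<beta> \<in> frac_field_in (range ev)" "\<beta> \<notin> range ev"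
  obtains z g where "prime_ideal (conductor (ev z * \<beta>))"
    "prime_ideal {c. [:c:] \<in> conductor (ev z * \<beta>)}"
    "{c. [:c:] \<in> conductor (ev z * \<beta>)} \<noteq> {0}"
    "g \<in> conductor (ev z * \<beta>)"
    "\<forall>p\<in>conductor (ev z * \<beta>). \<exists>q r. p = g * q + r \<and> (\<forall>i. [:coeff r i:] \<in> conductor (ev z * \<beta>))"
proof -
  define con where "con \<gamma> = {c. [:c:] \<in> conductor \<gamma>}" for \<gamma>
  have conI: "is_ideal (con \<gamma>)" for \<gamma>
  proof -
    note I = is_ideal_conductor[of \<gamma>]
    have "[:x + y:] \<in> conductor \<gamma>" if "[:x:] \<in> conductor \<gamma>" "[:y:] \<in> conductor \<gamma>" for x y
      using ideal_add[OF I that] by simp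
    moreover have "[:r * x:] \<in> conductor \<gamma>" if "[:x:] \<in> conductor \<gamma>" for r x
      using ideal_mult_left[OF I that, of "[:r:]"] by (simp add: mult.commute)
    ultimately show ?thesis using ideal_zero[OF I] by (auto simp: is_ideal_def con_def)
  qed
  have con1: "1 \<in> con \<gamma> \<longleftrightarrow> \<gamma> \<in> range ev" for \<gamma>
    using one_mem_conductor by (simp add: con_def flip: one_pCons)
  have con_mono: "con \<gamma> \<subseteq> con (ev q * \<gamma>)" for \<gamma> q
    using conductor_mono by (auto simp: con_def)
  define F where "F = {con (ev z * \<beta>) | z. ev z * \<beta> \<notin> range ev}"
  have "ev 1 * \<beta> \<notin> range ev" using \<beta>(2) by (simp add: ev_one)
  then have "F \<noteq> {}" unfolding F_def by blast
  moreover have "noetherian_ring TYPE('a)" using ded unfolding dedekind_ring_def by blast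
  moreover have "is_ideal I" if "I \<in> F" for I using that conI unfolding F_def by blast
  ultimately obtain P where P: "P \<in> F" "\<And>J. J \<in> F \<Longrightarrow> P \<subseteq> J \<Longrightarrow> J = P"
    by (elim noetherian_maximal_member[rotated 2]) auto
  then obtain z where z: "P = con (ev z * \<beta>)" "ev z * \<beta> \<notin> range ev" unfolding F_def by blast
  define \<gamma> where "\<gamma> = ev z * \<beta>"
  have P\<gamma>: "P = con \<gamma>" using z by (simp add: \<gamma>_def)
  \<comment> \<open>Maximality of \<open>P\<close>: multiples of \<gamma> outside the ring all have
    the same contraction.\<close>
  have con_eq: "con (ev w * \<gamma>) = P" if w: "ev w * \<gamma> \<notin> range ev" for w
  proof (rule P(2))
    have "ev w * \<gamma> = ev (w * z) * \<beta>" by (simp add: \<gamma>_def ev_mult mult.assoc)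
    then show "con (ev w * \<gamma>) \<in> F" unfolding F_def using w by auto
    show "P \<subseteq> con (ev w * \<gamma>)" using con_mono P\<gamma> by simp
  qed
  have primeP: "prime_ideal P"
    unfolding prime_ideal_def
  proof (intro conjI allI impI)
    show "is_ideal P" using conI P\<gamma> by simp
    show "P \<noteq> UNIV" using con1[of \<gamma>] z(2) P\<gamma> by (auto simp: \<gamma>_def)
    fix u v assume uv: "u * v \<in> P"
    show "u \<in> P \<or> v \<in> P"
    proof (rule disjCI)
      assume "v \<notin> P"
      then have "con (ev [:v:] * \<gamma>) = P"
        by (intro con_eq) (simp add: P\<gamma> con_def mem_conductor_iff)
      moreover have "u \<in> con (ev [:v:] * \<gamma>)"
        using uv by (simp add: P\<gamma> con_def conductor_mult) (simp add: mult.commute)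
      ultimately show "u \<in> P" by simp
    qed
  qed
  \<comment> \<open>Writing \<beta> with a denominator from \<open>R\<close> puts a nonzero constant
    into its conductor.\<close>
  have P0: "P \<noteq> {0}"
  proof -
    obtain x y where xy: "\<beta> = ev x / ev y" "ev y \<noteq> 0" using \<beta>(1) unfolding frac_field_in_def by blast
    have "f \<noteq> 0" using f(1) by auto
    then obtain r w where r: "r \<noteq> 0" "h r = ev (y * w)"
      using nonzero_constant_multiple[OF _ f(2) xy(2)] by blast
    have "ev [:r:] * \<beta> = ev (w * x)"
      using xy r(2) by (simp add: ev_const ev_mult)
    then have "r \<in> con \<beta>" by (simp add: con_def mem_conductor_iff)
    then have "r \<in> P" using con_mono P\<gamma> \<gamma>_def by blast
    then show ?thesis using r(1) by blast
  qed
  have mxP: "maximal_ideal P" using ded primeP P0 unfolding dedekind_ring_def by blast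
  define Q where "Q d \<longleftrightarrow> (\<exists>w g. ev w * \<gamma> \<notin> range ev \<and> g \<in> conductor (ev w * \<gamma>) \<and>
    lead_coeff g = 1 \<and> degree g = d)" for d
  \<comment> \<open>The monic \<open>f\<close> vanishes at \<alpha>, so it lies in every conductor
    and the least degree exists.\<close>
  have "Q (degree f)"
    unfolding Q_def using f z(2) mem_conductor_of_root
    by (intro exI[of _ 1] exI[of _ f]) (auto simp: ev_one \<gamma>_def)
  then have "Q (LEAST d. Q d)" by (rule LeastI)
  then obtain w g where w: "ev w * \<gamma> \<notin> range ev" and g: "g \<in> conductor (ev w * \<gamma>)" "lead_coeff g = 1"
    and gl: "degree g = (LEAST d. Q d)"
    unfolding Q_def by blast
  have min: "degree g \<le> degree g'"
    if "ev v * \<gamma> \<notin> range ev" "g' \<in> conductor (ev v * \<gamma>)" "lead_coeff g' = 1" for v g'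
    unfolding gl using that by (intro Least_le) (auto simp: Q_def)
  define \<delta> where "\<delta> = ev w * \<gamma>"
  \<comment> \<open>Further multiples of \<delta> outside the ring keep both the contraction
    \<open>P\<close> and the minimality of \<open>g\<close>, so \<open>g\<close> and
    \<open>P\<close> generate all their conductors.\<close>
  have div: "\<exists>q r. p = g * q + r \<and> (\<forall>i. coeff r i \<in> P)"
    if v: "ev v * \<delta> \<notin> range ev" and p: "p \<in> conductor (ev v * \<delta>)" for v p
  proof -
    have eq: "ev v * \<delta> = ev (v * w) * \<gamma>" by (simp add: \<delta>_def ev_mult mult.assoc)
    have c: "{c. [:c:] \<in> conductor (ev v * \<delta>)} = P"
      using con_eq[of "v * w"] v unfolding eq con_def by blast
    have "g \<in> conductor (ev v * \<delta>)" using g(1) conductor_mono unfolding \<delta>_def by blast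
    moreover have "degree g \<le> degree g'" if "g' \<in> conductor (ev v * \<delta>)" "lead_coeff g' = 1" for g'
      using min that v unfolding eq by blast
    ultimately obtain q r where "p = g * q + r" "\<And>i. [:coeff r i:] \<in> conductor (ev v * \<delta>)"
      using min_monic_division[OF is_ideal_conductor _ _ g(2) _ p] mxP c by metis
    then show ?thesis using c by blast
  qed
  have P\<delta>: "P = {c. [:c:] \<in> conductor \<delta>}" using con_eq[OF w] by (simp add: con_def \<delta>_def)
  have "prime_ideal (conductor \<delta>)"
    unfolding prime_ideal_def
  proof (intro conjI allI impI)
    show "is_ideal (conductor \<delta>)" by (rule is_ideal_conductor)
    show "conductor \<delta> \<noteq> UNIV" using w one_mem_conductor \<delta>_def by blast
    fix p q assume pq: "p * q \<in> conductor \<delta>"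
    show "p \<in> conductor \<delta> \<or> q \<in> conductor \<delta>"
    proof (rule disjCI)
      assume "q \<notin> conductor \<delta>"
      then have "ev q * \<delta> \<notin> range ev" by (simp add: mem_conductor_iff)
      \<comment> \<open>This conductor has the same generators \<open>g\<close> and \<open>P\<close>
        as that of \<delta>, so \<open>p\<close> lies in the latter too.\<close>
      moreover have "p \<in> conductor (ev q * \<delta>)" using pq by (simp add: conductor_mult)
      ultimately obtain k r where kr: "p = g * k + r" "\<forall>i. coeff r i \<in> P"
        using div by blast
      have "r \<in> conductor \<delta>"
        by (rule poly_mem_ideal_of_coeffs[OF is_ideal_conductor]) (use kr(2) P\<delta> in blast)
      moreover have "g * k \<in> conductor \<delta>"
        using g(1) \<delta>_def ideal_mult_right[OF is_ideal_conductor] by blast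
      ultimately show "p \<in> conductor \<delta>" using kr(1) ideal_add[OF is_ideal_conductor] by blast
    qed
  qed
  moreover have "\<exists>q r. p = g * q + r \<and> (\<forall>i. [:coeff r i:] \<in> conductor \<delta>)" if "p \<in> conductor \<delta>" for p
    using div[of 1 p] that w P\<delta> by (auto simp: ev_one \<delta>_def)
  moreover have "\<delta> = ev (w * z) * \<beta>" by (simp add: \<delta>_def \<gamma>_def ev_mult mult.assoc)
  ultimately show thesis
    using that[of "w * z" g] primeP P0 g(1) unfolding P\<delta> \<delta>_def[symmetric] by simp
qed

text \<open>Put \<open>v = t * ev z * \<beta>\<close>. Membership of \<open>v\<close> in the conductor can be divided by \<open>t\<close> locally,
  and an integral equation of \<open>\<beta>\<close>, homogenised by \<open>t * ev z\<close>, puts a power of \<open>v\<close> into \<open>t\<close> times the ring.\<close>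

lemma integral_conductor_not_locally_principal:
  assumes int: "integral_over (range ev) \<beta>"
    and prime: "prime_ideal (conductor (ev z * \<beta>))"
    and t: "t \<in> conductor (ev z * \<beta>)" "ev t \<noteq> 0"
    and loc: "\<And>m. m \<in> conductor (ev z * \<beta>) \<Longrightarrow>
      \<exists>s w. s \<notin> conductor (ev z * \<beta>) \<and> ev (s * m) = ev (t * w)"
  shows False
proof -
  let ?M = "conductor (ev z * \<beta>)"
  obtain v where v: "ev t * (ev z * \<beta>) = ev v" using t(1) unfolding mem_conductor_iff by auto
  have "v \<notin> ?M"
  proof
    assume "v \<in> ?M"
    then obtain s w where s: "s \<notin> ?M" "ev (s * v) = ev (t * w)" using loc by blast
    then have "ev t * (ev s * (ev z * \<beta>)) = ev t * ev w"
      using v by (simp add: ev_mult mult.left_commute)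
    then have "ev s * (ev z * \<beta>) = ev w" using t(2) by simp
    then show False using s(1) by (simp add: mem_conductor_iff)
  qed
  obtain p where p: "lead_coeff p = 1" "\<forall>i. coeff p i \<in> range ev" "poly p \<beta> = 0"
    using int unfolding integral_over_def by blast
  then have "\<forall>i. \<exists>q. coeff p i = ev q" by blast
  then obtain c where c: "\<And>i. coeff p i = ev (c i)" by metis
  define k where "k = degree p"
  \<comment> \<open>In the term of index \<open>i < k\<close>, the factor \<open>v ^ i\<close>
    absorbs \<open>\<beta> ^ i\<close>, and the remaining power \<open>(t * z) ^ (k - i)\<close>
    gives up one \<open>t\<close>; hence the lone \<open>z\<close> and the exponent
    \<open>k - Suc i\<close>.\<close>
  define W where "W = (\<Sum>i<k. c i * v ^ i * z * (t * z) ^ (k - Suc i))"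
  have summand: "ev (t * z) ^ k * (ev (c i) * \<beta> ^ i) = ev t * ev (c i * v ^ i * z * (t * z) ^ (k - Suc i))"
    if "i < k" for i
  proof -
    have "k = i + Suc (k - Suc i)" using that by simp
    then have "ev (t * z) ^ k = ev (t * z) ^ i * (ev (t * z) * ev (t * z) ^ (k - Suc i))"
      by (metis power_add power_Suc)
    moreover have "ev v ^ i = ev (t * z) ^ i * \<beta> ^ i"
      by (simp add: ev_mult mult.assoc flip: v power_mult_distrib)
    ultimately show ?thesis by (simp add: ev_mult ev_power)
  qed
  have "0 = ev (t * z) ^ k * (\<Sum>i\<le>k. ev (c i) * \<beta> ^ i)"
    using p(3) by (simp add: poly_altdef c k_def)
  also have "\<dots> = (\<Sum>i\<le>k. ev (t * z) ^ k * (ev (c i) * \<beta> ^ i))"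
    by (rule sum_distrib_left)
  also have "\<dots> = (\<Sum>i<k. ev (t * z) ^ k * (ev (c i) * \<beta> ^ i)) + ev (t * z) ^ k * (ev (c k) * \<beta> ^ k)"
    by (simp flip: lessThan_Suc_atMost)
  also have "(\<Sum>i<k. ev (t * z) ^ k * (ev (c i) * \<beta> ^ i)) = ev (t * W)"
    unfolding W_def sum_distrib_left ev_sum
    by (rule sum.cong) (simp_all add: summand flip: ev_mult[of t])
  \<comment> \<open>The leading coefficient \<open>ev (c k)\<close> is 1, so the top term is exactly
    a power of \<open>v\<close>.\<close>
  also have "ev (t * z) ^ k * (ev (c k) * \<beta> ^ k) = ev (v ^ k)"
    using p(1) by (simp add: ev_power ev_mult mult.assoc flip: v power_mult_distrib c k_def)
  finally have "ev (v ^ k) = ev (t * (- W))"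
    by (simp add: ev_mult ev_uminus eq_neg_iff_add_eq_0 add.commute)
  moreover have "t * (- W) \<in> ?M" using ideal_mult_right[OF is_ideal_conductor t(1)] .
  ultimately have "v ^ k \<in> ?M" using conductor_cong by blast
  then show False using \<open>v \<notin> ?M\<close> prime_ideal_power[OF prime] by blast
qed

end

section \<open>Integral closedness of \<open>R[\<alpha>]\<close>: primes containing \<open>a\<close>
  and primes avoiding it\<close>

theorem theorem1p3:
  fixes a :: "'a::idom" and n :: nat and h :: "'a \<Rightarrow> 'L::field" and \<alpha> :: 'L
  assumes "dedekind_ring TYPE('a)"
    and "square_free_elem a"
    and "irreducible (monom 1 n - [:a:])"
    and "inj_ring_hom h"
    and "poly (map_poly h (monom 1 n - [:a:])) \<alpha> = 0"
    and "\<forall>P :: 'a set. prime_ideal P \<and> P \<noteq> {0} \<and> of_nat n \<in> P \<longrightarrow> a \<in> P"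
  shows "integrally_closed_in (adjoin h \<alpha>) (frac_field_in (adjoin h \<alpha>))"
proof -
  interpret adjunction h \<alpha> using assms(4) by unfold_locales
  define f where "f = monom 1 n - [:a:]"
  have evf: "ev f = 0" using assms(5) by (simp add: f_def ev_def)
  \<comment> \<open>For \<open>n = 0\<close> the polynomial would be a constant killed by the
    injective \<open>h\<close>, hence zero and not irreducible.\<close>
  have n: "n \<noteq> 0"
  proof
    assume "n = 0"
    then have "f = [:1 - a:]" by (simp add: f_def monom_0)
    then have "f = 0" using evf by (simp add: ev_const h_eq_zero)
    then show False using assms(3) by (simp add: f_def)
  qed
  have degf: "degree f = n" "lead_coeff f = 1"
  proof -
    have "coeff f n = 1" using n by (simp add: f_def coeff_pCons split: nat.split)
    moreover from this have "degree f = n"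
      by (intro antisym degree_le le_degree) (auto simp: f_def coeff_pCons split: nat.split)
    ultimately show "degree f = n" "lead_coeff f = 1" by auto
  qed
  define X where "X = [:0, 1 :: 'a:]"
  have f_eq: "f = X ^ n - [:a:]" by (simp add: f_def X_def monom_altdef)
  have eva: "ev [:a:] = ev (X ^ n)" using evf by (simp add: f_eq ev_diff)
  show ?thesis
    unfolding integrally_closed_in_def adjoin_eq
  proof (intro ballI impI, rule ccontr)
    fix \<beta> assume \<beta>: "\<beta> \<in> frac_field_in (range ev)" "integral_over (range ev) \<beta>" "\<beta> \<notin> range ev"
    obtain z g where zg: "prime_ideal (conductor (ev z * \<beta>))"
      "prime_ideal {c. [:c:] \<in> conductor (ev z * \<beta>)}"
      "{c. [:c:] \<in> conductor (ev z * \<beta>)} \<noteq> {0}"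
      "g \<in> conductor (ev z * \<beta>)"
      "\<forall>p\<in>conductor (ev z * \<beta>). \<exists>q r. p = g * q + r \<and> (\<forall>i. [:coeff r i:] \<in> conductor (ev z * \<beta>))"
      using prime_conductor[OF assms(1) degf(2) evf \<beta>(1,3)] by blast
    define M where "M = conductor (ev z * \<beta>)"
    define P where "P = {c. [:c:] \<in> M}"
    note zg = zg[folded M_def, folded P_def]
    have MI: "is_ideal M" unfolding M_def by (rule is_ideal_conductor)
    have no_t: False if "t \<in> M" "ev t \<noteq> 0"
      "\<And>m. m \<in> M \<Longrightarrow> \<exists>s w. s \<notin> M \<and> ev (s * m) = ev (t * w)" for t
      using integral_conductor_not_locally_principal[OF \<beta>(2) zg(1)[unfolded M_def]] that
      unfolding M_def by blast
    have fM: "f \<in> M" unfolding M_def using evf by (rule mem_conductor_of_root)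
    show False
    proof (cases "a \<in> P")
      case True
      obtain s where s: "s \<notin> P" "\<And>x. x \<in> P \<Longrightarrow> a dvd s * x"
        using square_free_uniformizer[OF assms(1) zg(2,3) assms(2) True] by blast
      \<comment> \<open>Otherwise the nonzero \<open>s\<close> would annihilate the nonzero ideal
        \<open>P\<close> of a domain. This makes \<alpha> nonzero.\<close>
      have "a \<noteq> 0"
      proof
        assume "a = 0"
        then have "s * x = 0" if "x \<in> P" for x using s(2)[OF that] by simp
        moreover have "s \<noteq> 0" using s(1) ideal_zero[OF prime_ideal_is_ideal[OF zg(2)]] by auto
        ultimately have "x = 0" if "x \<in> P" for x using that by simp
        then show False using zg(3) ideal_zero[OF prime_ideal_is_ideal[OF zg(2)]] by blast
      qed
      have "f + [:a:] \<in> M" using fM True by (intro ideal_add[OF MI]) (auto simp: P_def)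
      then have "X ^ n \<in> M" by (simp add: f_eq)
      then have "X \<in> M" by (rule prime_ideal_power[OF zg(1)])
      moreover have "ev X \<noteq> 0"
        using eva n \<open>a \<noteq> 0\<close> by (auto simp: ev_power ev_const h_eq_zero zero_power)
      moreover have "\<exists>s w. s \<notin> M \<and> ev (s * m) = ev (X * w)" if m: "m \<in> M" for m
      proof -
        obtain m0 m' where m': "m = pCons m0 m'" by (cases m)
        have m_eq: "m = [:m0:] + X * m'" by (simp add: m' X_def)
        then have "[:m0:] = m - X * m'" by simp
        then have "m0 \<in> P"
          unfolding P_def using ideal_diff[OF MI m ideal_mult_right[OF MI \<open>X \<in> M\<close>]] by simp
        \<comment> \<open>Multiplication by \<open>s\<close> moves the constant term of
          \<open>m\<close> into \<open>aR\<close>, and the value of \<open>a\<close> is a positive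
          power of \<alpha>.\<close>
        then obtain r where r: "s * m0 = a * r" using s(2) by blast
        have "[:s:] * m = [:a:] * [:r:] + X * ([:s:] * m')"
          by (simp add: m_eq r smult_add_right)
        then have "ev ([:s:] * m) = ev (X ^ n * [:r:] + X * ([:s:] * m'))"
          by (simp only: ev_add ev_mult eva)
        also have "X ^ n * [:r:] + X * ([:s:] * m') = X * (X ^ (n - 1) * [:r:] + [:s:] * m')"
          using n by (cases n) (auto simp: algebra_simps)
        finally have "ev ([:s:] * m) = ev (X * (X ^ (n - 1) * [:r:] + [:s:] * m'))" .
        moreover have "[:s:] \<notin> M" using s(1) by (simp add: P_def)
        ultimately show ?thesis by blast
      qed
      ultimately show False by (rule no_t)
    next
      case False
      obtain \<pi> s where \<pi>: "\<pi> \<in> P" "\<pi> \<noteq> 0" "s \<notin> P" "\<And>x. x \<in> P \<Longrightarrow> \<pi> dvd s * x"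
        using dedekind_uniformizer[OF assms(1) zg(2,3)] by blast
      have nP: "of_nat n \<notin> P" using False assms(6) zg(2,3) by blast
      have mem_of_coeffs: "r \<in> M" if "\<forall>i. [:coeff r i:] \<in> M" for r
        using that poly_mem_ideal_of_coeffs[OF MI] by blast
      have scaled: "\<exists>r'. [:s:] * r = [:\<pi>:] * r'" if "\<forall>i. [:coeff r i:] \<in> M" for r
      proof -
        have "\<pi> dvd coeff ([:s:] * r) i" for i using that \<pi>(4) by (simp add: P_def)
        then have "[:\<pi>:] dvd [:s:] * r" by (simp add: const_poly_dvd_iff)
        then show ?thesis by (auto simp: dvd_def)
      qed
      obtain q r where qr: "f = g * q + r" "\<forall>i. [:coeff r i:] \<in> M" using zg(5) fM by blast
      \<comment> \<open>otherwise \<open>g\<^sup>2\<close> divides \<open>f\<close> modulo \<open>P\<close>, so the derivative \<open>n X\<^sup>n\<^sup>-\<^sup>1\<close> of \<open>f\<close> lies in \<open>M\<close>\<close>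
      have "q \<notin> M"
      proof
        assume q: "q \<in> M"
        have "[:coeff (pderiv r) i:] \<in> M" for i
          using ideal_mult_left[OF MI, of "[:coeff r (Suc i):]" "[:of_nat (Suc i):]"] qr(2)
          by (simp add: coeff_pderiv mult.commute)
        then have "pderiv r \<in> M" using mem_of_coeffs by blast
        moreover have "pderiv f = pderiv g * q + g * pderiv q + pderiv r"
          by (simp add: qr(1) pderiv_add pderiv_mult algebra_simps)
        ultimately have "pderiv f \<in> M"
          using ideal_add[OF MI] ideal_mult_left[OF MI q] ideal_mult_right[OF MI zg(4)] by metis
        moreover have "pderiv f = [:of_nat n:] * X ^ (n - 1)"
          by (simp add: f_def pderiv_diff pderiv_monom pderiv_pCons X_def)
            (simp add: monom_altdef)
        \<comment> \<open>Both alternatives fail: \<open>n\<close> is outside \<open>P\<close>, and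
          \<open>X \<in> M\<close> would put \<open>X ^ n - f\<close>, which is the constant
          \<open>a\<close>, into \<open>M\<close>.\<close>
        ultimately have "[:of_nat n:] \<in> M \<or> X \<in> M"
          using prime_ideal_mult[OF zg(1)] prime_ideal_power[OF zg(1)] by metis
        then have "X \<in> M" using nP by (auto simp: P_def)
        then have "X ^ n \<in> M" using n ideal_mult_right[OF MI] by (cases n) auto
        then have "X ^ n - f \<in> M" using ideal_diff[OF MI] fM by blast
        then show False using False by (simp add: f_eq P_def)
      qed
      have "[:\<pi>:] \<in> M" using \<pi>(1) by (simp add: P_def)
      moreover have "ev [:\<pi>:] \<noteq> 0" using \<pi>(2) by (simp add: ev_const h_eq_zero)
      moreover have "\<exists>s w. s \<notin> M \<and> ev (s * m) = ev ([:\<pi>:] * w)" if m: "m \<in> M" for m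
      proof -
        obtain q1 r1 where qr1: "m = g * q1 + r1" "\<forall>i. [:coeff r1 i:] \<in> M" using zg(5) m by blast
        obtain r' r1' where r': "[:s:] * r = [:\<pi>:] * r'" "[:s:] * r1 = [:\<pi>:] * r1'"
          using scaled qr(2) qr1(2) by metis
        \<comment> \<open>The factor \<open>q\<close> replaces \<open>g\<close> by
          \<open>g * q = f - r\<close>, where \<open>f\<close> vanishes at \<alpha>; the factor
          \<open>s\<close> then turns coefficients in \<open>P\<close> into multiples of
          \<pi>.\<close>
        have "([:s:] * q) * m = [:s:] * (f - r) * q1 + q * ([:s:] * r1)"
          unfolding qr1(1) qr(1) by (simp only: algebra_simps)
        also have "\<dots> = [:s:] * f * q1 - ([:s:] * r) * q1 + q * ([:s:] * r1)"
          by (simp only: algebra_simps)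
        also have "\<dots> = f * ([:s:] * q1) + [:\<pi>:] * (q * r1' - r' * q1)"
          unfolding r' by (simp only: algebra_simps)
        finally have "ev (([:s:] * q) * m) = ev (f * ([:s:] * q1) + [:\<pi>:] * (q * r1' - r' * q1))"
          by (rule arg_cong)
        then have "ev (([:s:] * q) * m) = ev ([:\<pi>:] * (q * r1' - r' * q1))"
          by (simp only: ev_add ev_mult evf mult_zero_left add_0_left)
        moreover have "[:s:] * q \<notin> M"
          using prime_ideal_mult[OF zg(1)] \<pi>(3) \<open>q \<notin> M\<close> unfolding P_def by blast
        ultimately show ?thesis by blast
      qed
      ultimately show False by (rule no_t)
    qed
  qed
qed

end
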